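(* Let $p>1$ and $\alpha<0$ be real numbers, and set $$C_p(\alpha):=\left(\frac{p-\alpha-1}{p}\right)^{p}.$$ Then for every finitely supported complex sequence $u=(u_n)_{n\in\mathbb{N}_0}$ with $u_0=0$, the inequality $$\sum_{n=1}^{\infty}n^{\alpha}\,|\nabla u_n|^{p}\;\ge\;C_p(\alpha)\sum_{n=1}^{\infty}(n+1)^{\alpha-p}\,|u_n|^{p}$$ holds. Moreover, the constant $C_p(\alpha)$ is optimal, i.e. if a real number $C$ is such that $\sum_{n=1}^{\infty}n^{\alpha}|\nabla u_n|^{p}\ge C\sum_{n=1}^{\infty}(n+1)^{\alpha-p}|u_n|^{p}$ for all such $u$, then $C\le C_p(\alpha)$.
   Context: $\mathbb{N}_0=\{0,1,2,\dots\}$. The discrete gradient is $\nabla u_n:=u_n-u_{n-1}$ for $n\ge1$. *)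

theory Defs
  imports "HOL-Analysis.Analysis"
begin

(* Only used for n >= 1, where n - 1 is ordinary subtraction. *)
definition discrete_gradient :: "(nat \<Rightarrow> complex) \<Rightarrow> nat \<Rightarrow> complex" where
  "discrete_gradient u n = u n - u (n - 1)"

definition hardy_const :: "real \<Rightarrow> real \<Rightarrow> real" where
  "hardy_const p \<alpha> = ((p - \<alpha> - 1) / p) powr p"

definition admissible :: "(nat \<Rightarrow> complex) \<Rightarrow> bool" where
  "admissible u \<longleftrightarrow> finite {n. u n \<noteq> 0} \<and> u 0 = 0"

(* For admissible u and p > 0 the sums below have only finitely many nonzero terms,
   so the value 0 of infsum on non-summable families never arises.
   Note that 0 powr p = 0. *)
definition hardy_inequality :: "real \<Rightarrow> real \<Rightarrow> real \<Rightarrow> (nat \<Rightarrow> complex) \<Rightarrow> bool" where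
  "hardy_inequality p \<alpha> C u \<longleftrightarrow>
     (\<Sum>\<^sub>\<infinity>n\<in>{1..}. real n powr \<alpha> * cmod (discrete_gradient u n) powr p)
       \<ge> C * (\<Sum>\<^sub>\<infinity>n\<in>{1..}. real (n + 1) powr (\<alpha> - p) * cmod (u n) powr p)"

end

theory Submission
  imports Defs "HOL-Real_Asymp.Real_Asymp"
begin

text \<open>
  Put \<open>s = (p - \<alpha> - 1) / p\<close>, so that \<open>C\<^sub>p(\<alpha>) = s\<^sup>p\<close>. The inequality comes from a discrete Picone
  argument with the supersolution \<open>g\<^sub>n = s (1\<^bsup>s-1\<^esup> + \<dots> + n\<^bsup>s-1\<^esup>)\<close>: its flux
  \<open>n\<^sup>\<alpha> (\<nabla>g\<^sub>n)\<^bsup>p-1\<^esup>\<close> is exactly \<open>s\<^bsup>p-1\<^esup> n\<^bsup>-s\<^esup>\<close>, whose decrements are at least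
  \<open>s\<^sup>p (n+1)\<^bsup>-s-1\<^esup>\<close>, and \<open>g\<^sub>n \<le> (n+1)\<^sup>s\<close>.
  For optimality, take \<open>u\<^sub>n = n\<^sup>s\<close> up to \<open>N\<close>, followed by linear decay to 0 at \<open>2N\<close>. The decay
  costs at most 1, uniformly in \<open>N\<close>, while below \<open>N\<close> the terms of the two sums are asymptotic to
  \<open>s\<^sup>p / n\<close> and \<open>1 / n\<close>, so that the divergence of the harmonic series decides.
\<close>

section \<open>Power estimates and the discrete Picone inequality\<close>

lemma powr_diff_Suc_mvt:
  fixes x r :: real
  assumes "x > 0"
  obtains z where "x < z" "z < x + 1" "(x + 1) powr r - x powr r = r * z powr (r - 1)"
proof -
  have "\<exists>z>x. z < x + 1 \<and> (x + 1) powr r - x powr r = (x + 1 - x) * (r * z powr (r - 1))"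
    using assms by (intro MVT2) (auto intro!: has_real_derivative_powr)
  then show thesis using that by auto
qed

text \<open>The map sending (x, a) to x^p / a^(p-1) is the perspective of the convex function x^p.
  Being convex and homogeneous of degree 1, it is subadditive. The last assumption is there because
  division by zero gives 0, which would erase the contribution of \<open>y\<close> when
  \<open>b = 0\<close>.\<close>

lemma powr_add_divide_le:
  fixes p x y a b :: real
  assumes p: "p > 1" and x: "x \<ge> 0" and y: "y \<ge> 0" and a: "a > 0" and b: "b \<ge> 0"
    and y0: "b = 0 \<Longrightarrow> y = 0"
  shows "(x + y) powr p / (a + b) powr (p - 1) \<le> x powr p / a powr (p - 1) + y powr p / b powr (p - 1)"
proof -
  \<comment> \<open>Covers the degenerate cases \<open>x = 0\<close> and \<open>y = 0\<close>, where
    only the denominator has to be decreased.\<close>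
  have anti: "z powr p / (c + d) powr (p - 1) \<le> z powr p / c powr (p - 1)"
    if "c > 0" "d \<ge> 0" for z c d :: real
    using that p by (intro divide_left_mono powr_mono2) auto
  have split: "w powr p / c powr (p - 1) = c * (w / c) powr p" if "c > 0" "w > 0" for w c :: real
    using that by (simp add: powr_divide powr_diff)
  consider "b = 0" | "b > 0" "x = 0" | "b > 0" "y = 0" | "b > 0" "x > 0" "y > 0"
    using b x y by linarith
  then show ?thesis
  proof cases
    case 1
    then show ?thesis using y0 by simp
  next
    case 2
    then show ?thesis using anti[of b a y] a p by (simp add: add.commute)
  next
    case 3
    then show ?thesis using anti[of a b x] a p by simp
  next
    case 4
    \<comment> \<open>Jensen at the points x/a and y/b with weights a/(a+b) and b/(a+b), whose
      weighted mean is (x+y)/(a+b).\<close>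
    have "((1 - b / (a + b)) *\<^sub>R (x / a) + (b / (a + b)) *\<^sub>R (y / b)) powr p
        \<le> (1 - b / (a + b)) * (x / a) powr p + (b / (a + b)) * (y / b) powr p"
      using 4 a p by (intro convex_onD[OF powr_convex]) auto
    moreover have "1 - b / (a + b) = a / (a + b)"
      using 4 a by (simp add: field_simps)
    ultimately have "((x + y) / (a + b)) powr p
        \<le> (a * (x / a) powr p + b * (y / b) powr p) / (a + b)"
      using 4 a by (simp add: add_divide_distrib)
    then have "(a + b) * ((x + y) / (a + b)) powr p \<le> a * (x / a) powr p + b * (y / b) powr p"
      using 4 a by (simp add: pos_le_divide_eq mult.commute)
    then show ?thesis
      using 4 a by (simp add: split)
  qed
qed

lemma sum_by_parts_zero:
  fixes F W :: "nat \<Rightarrow> real"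
  assumes "W 0 = 0"
  shows "(\<Sum>n=1..N. F n * (W n - W (n - 1))) = F (Suc N) * W N + (\<Sum>n=1..N. (F n - F (Suc n)) * W n)"
  using assms by (induction N) (auto simp: algebra_simps)

text \<open>\<open>F\<close> is the flux of \<open>g\<close> for the \<open>V\<close>-weighted
  p-Laplacian. Testing it against |u|^p / g^(p-1) and summing by parts leaves a nonnegative boundary
  term, which is dropped. The bound on each term is the subadditivity above, applied to g(n) = (g(n)
  - g(n-1)) + g(n-1).\<close>

lemma discrete_Picone:
  fixes u :: "nat \<Rightarrow> 'a::real_normed_vector" and V g :: "nat \<Rightarrow> real"
  assumes p: "p > 1" and u0: "u 0 = 0" and g0: "g 0 = 0"
    and g: "\<And>n. g n < g (Suc n)" and V: "\<And>n. V n \<ge> 0"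
  defines "F \<equiv> \<lambda>n. V n * (g n - g (n - 1)) powr (p - 1)"
  shows "(\<Sum>n=1..N. (F n - F (Suc n)) * (norm (u n) powr p / g n powr (p - 1)))
         \<le> (\<Sum>n=1..N. V n * norm (u n - u (n - 1)) powr p)"
proof -
  have gpos: "g n \<ge> 0 \<and> (n > 0 \<longrightarrow> g n > 0)" for n
    by (induction n) (use g g0 in \<open>auto intro: order.strict_implies_order order.strict_trans1\<close>)
  define W where "W n = norm (u n) powr p / g n powr (p - 1)" for n
  have "F n * (W n - W (n - 1)) \<le> V n * norm (u n - u (n - 1)) powr p" if n1: "n \<in> {1..N}" for n
  proof -
    obtain m where n: "n = Suc m"
      using n1 by (cases n) auto
    let ?a = "g n - g m" and ?x = "norm (u n - u m)"
    have a: "?a > 0" using g n by simp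
    \<comment> \<open>\<open>g\<close> vanishes only at 0, where \<open>u\<close> vanishes too; this
      is the degenerate side condition of \<open>powr_add_divide_le\<close>.\<close>
    have um: "norm (u m) = 0" if "g m = 0"
      using that gpos[of m] u0 by (cases "m = 0") auto
    have "norm (u n) powr p \<le> (?x + norm (u m)) powr p"
      using p norm_triangle_sub[of "u n" "u m"] by (intro powr_mono2) (auto simp: add.commute)
    then have "W n \<le> (?x + norm (u m)) powr p / (?a + g m) powr (p - 1)"
      unfolding W_def by (simp add: divide_right_mono)
    also have "\<dots> \<le> ?x powr p / ?a powr (p - 1) + norm (u m) powr p / g m powr (p - 1)"
      using p a gpos[of m] um by (intro powr_add_divide_le) auto
    finally have "W n - W m \<le> ?x powr p / ?a powr (p - 1)"
      by (simp add: W_def)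
    then have "F n * (W n - W m) \<le> F n * (?x powr p / ?a powr (p - 1))"
      using V by (intro mult_left_mono) (auto simp: F_def)
    also have "\<dots> = V n * ?x powr p"
      using a by (simp add: F_def n)
    finally show ?thesis by (simp add: n)
  qed
  then have "(\<Sum>n=1..N. F n * (W n - W (n - 1))) \<le> (\<Sum>n=1..N. V n * norm (u n - u (n - 1)) powr p)"
    by (intro sum_mono) auto
  moreover have "F (Suc N) * W N \<ge> 0"
    using V by (auto simp: F_def W_def)
  moreover have "W 0 = 0" by (simp add: W_def u0)
  ultimately show ?thesis
    using sum_by_parts_zero[of W F N] by (simp add: W_def)
qed

section \<open>The weighted Hardy inequality\<close>

lemma sum_powr_le_Suc_powr:
  fixes s :: real
  assumes s: "s > 0"
  shows "s * (\<Sum>k=1..n. real k powr (s - 1)) \<le> real (n + 1) powr s"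
\<comment> \<open>The term s k^(s-1) is compared with an increment of x^s. For s at most 1 the
  derivative decreases, so the interval [k-1, k] is used and the sum is at most n^s. For s > 1 it
  increases, so [k, k+1] is used, at the price of (n+1)^s.\<close>
proof (cases "s \<le> 1")
  case True
  have "s * (\<Sum>k=1..n. real k powr (s - 1)) \<le> real n powr s"
  proof (induction n)
    case (Suc n)
    have "s * real (Suc n) powr (s - 1) \<le> real (Suc n) powr s - real n powr s"
    \<comment> \<open>The mean value step needs a positive left endpoint; at \<open>n = 0\<close>
      the claim reads s <= 1.\<close>
    proof (cases "n = 0")
      case False
      then obtain z where z: "real n < z" "z < real n + 1"
        "(real n + 1) powr s - real n powr s = s * z powr (s - 1)"
        using powr_diff_Suc_mvt[of "real n" s] by auto
      have "(real n + 1) powr (s - 1) \<le> z powr (s - 1)"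
        using z True by (intro powr_mono2') auto
      then show ?thesis
        using z s by (simp add: add.commute)
    qed (use True in auto)
    with Suc show ?case by (simp add: algebra_simps)
  qed auto
  also have "\<dots> \<le> real (n + 1) powr s"
    using s by (intro powr_mono2) auto
  finally show ?thesis .
next
  case False
  show ?thesis
  proof (induction n)
    case (Suc n)
    obtain z where z: "real (Suc n) < z" "z < real (Suc n) + 1"
      "(real (Suc n) + 1) powr s - real (Suc n) powr s = s * z powr (s - 1)"
      using powr_diff_Suc_mvt[of "real (Suc n)" s] by auto
    have "real (Suc n) powr (s - 1) \<le> z powr (s - 1)"
      using z False by (intro powr_mono2) auto
    then have "s * real (Suc n) powr (s - 1) \<le> (real (Suc n) + 1) powr s - real (Suc n) powr s"
      using z s by simp
    with Suc show ?case by (simp add: algebra_simps)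
  qed auto
qed

lemma weighted_discrete_Hardy:
  fixes u :: "nat \<Rightarrow> 'a::real_normed_vector" and p \<alpha> :: real
  assumes p: "p > 1" and \<alpha>: "\<alpha> < p - 1" and u0: "u 0 = 0"
  shows "((p - \<alpha> - 1) / p) powr p * (\<Sum>n=1..N. real (n + 1) powr (\<alpha> - p) * norm (u n) powr p)
         \<le> (\<Sum>n=1..N. real n powr \<alpha> * norm (u n - u (n - 1)) powr p)"
proof -
  define s where "s = (p - \<alpha> - 1) / p"
  have s: "s > 0" using p \<alpha> by (simp add: s_def)
  have \<alpha>_eq: "\<alpha> = p - 1 - s * p" using p by (simp add: s_def)
  define g where "g n = s * (\<Sum>k=1..n. real k powr (s - 1))" for n
  have g_diff: "g (Suc n) - g n = s * real (Suc n) powr (s - 1)" for n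
    by (simp add: g_def algebra_simps)
  have g_less: "g n < g (Suc n)" for n
    using g_diff[of n] s by (smt (verit) mult_pos_pos of_nat_0_less_iff powr_gt_zero zero_less_Suc)
  define F where "F n = real n powr \<alpha> * (g n - g (n - 1)) powr (p - 1)" for n
  have F: "F (Suc n) = s powr (p - 1) * real (Suc n) powr (- s)" for n
  proof -
    \<comment> \<open>This identity makes the flux a pure power of n.\<close>
    have "\<alpha> + (s - 1) * (p - 1) = - s" by (simp add: \<alpha>_eq algebra_simps)
    then show ?thesis
      using s by (simp add: F_def g_diff powr_mult powr_powr flip: powr_add)
  qed
  have "s powr p * (real (n + 1) powr (\<alpha> - p) * norm (u n) powr p)
      \<le> (F n - F (Suc n)) * (norm (u n) powr p / g n powr (p - 1))" if n1: "n \<in> {1..N}" for n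
  proof -
    obtain m where m: "n = Suc m"
      using n1 by (cases n) auto
    obtain z where z: "real n < z" "z < real n + 1"
      "(real n + 1) powr (- s) - real n powr (- s) = - s * z powr (- s - 1)"
      using powr_diff_Suc_mvt[of "real n" "- s"] n1 by auto
    \<comment> \<open>Evaluating the derivative of x^(-s) at the right endpoint is what produces n +
      1 in the weight.\<close>
    have "(real n + 1) powr (- s - 1) \<le> z powr (- s - 1)"
      using z s by (intro powr_mono2') auto
    then have "s * (real n + 1) powr (- s - 1) \<le> s * z powr (- s - 1)"
      using s by simp
    also have "\<dots> = real n powr (- s) - (real n + 1) powr (- s)"
      using z by simp
    finally have "s powr (p - 1) * (s * (real n + 1) powr (- s - 1))
        \<le> s powr (p - 1) * (real n powr (- s) - (real n + 1) powr (- s))"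
      by (intro mult_left_mono) auto
    moreover have "s powr (p - 1) * s = s powr p"
      using s by (simp add: powr_diff)
    moreover have "F n = s powr (p - 1) * real n powr (- s)"
      using F[of m] m by simp
    moreover have "F (Suc n) = s powr (p - 1) * (real n + 1) powr (- s)"
      using F[of n] by (simp add: add.commute)
    ultimately have "s powr p * (real n + 1) powr (- s - 1) \<le> F n - F (Suc n)"
      by (simp add: right_diff_distrib mult.assoc[symmetric])
    \<comment> \<open>Uses g(n) <= (n+1)^s and the exponent count (alpha - p) + s(p-1) = -s -
      1.\<close>
    moreover have "(real n + 1) powr (\<alpha> - p) \<le> (real n + 1) powr (- s - 1) / g n powr (p - 1)"
    proof -
      have gn: "g n > 0"
        using s n1 by (auto simp: g_def intro!: mult_pos_pos sum_pos)
      have "g n powr (p - 1) \<le> ((real n + 1) powr s) powr (p - 1)"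
        using gn p sum_powr_le_Suc_powr[OF s, of n]
        by (intro powr_mono2) (auto simp: g_def add.commute)
      then have "(real n + 1) powr (\<alpha> - p) * g n powr (p - 1)
          \<le> (real n + 1) powr (\<alpha> - p) * (real n + 1) powr (s * (p - 1))"
        by (intro mult_left_mono) (auto simp: powr_powr)
      also have "\<dots> = (real n + 1) powr (- s - 1)"
        unfolding powr_add[symmetric] by (rule arg_cong) (simp add: \<alpha>_eq algebra_simps)
      finally show ?thesis
        using gn by (simp add: pos_le_divide_eq)
    qed
    ultimately have "s powr p * (real n + 1) powr (\<alpha> - p) \<le> (F n - F (Suc n)) / g n powr (p - 1)"
      by (smt (verit) divide_right_mono mult_left_mono powr_ge_zero times_divide_eq_right)
    then have "s powr p * (real n + 1) powr (\<alpha> - p) * norm (u n) powr p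
        \<le> (F n - F (Suc n)) / g n powr (p - 1) * norm (u n) powr p"
      by (intro mult_right_mono) auto
    then show ?thesis by (simp add: mult_ac add.commute)
  qed
  then have "s powr p * (\<Sum>n=1..N. real (n + 1) powr (\<alpha> - p) * norm (u n) powr p)
      \<le> (\<Sum>n=1..N. (F n - F (Suc n)) * (norm (u n) powr p / g n powr (p - 1)))"
    unfolding sum_distrib_left by (intro sum_mono) auto
  also have "\<dots> \<le> (\<Sum>n=1..N. real n powr \<alpha> * norm (u n - u (n - 1)) powr p)"
    unfolding F_def using p u0 g_less
    by (intro discrete_Picone[where V = "\<lambda>n. real n powr \<alpha>"]) (auto simp: g_def)
  finally show ?thesis by (simp add: s_def)
qed

section \<open>Passage to finite sums, and optimality of the constant\<close>

lemma hardy_inequality_iff_sum: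
  assumes u0: "\<And>n. n \<ge> N \<Longrightarrow> u n = 0"
  shows "hardy_inequality p \<alpha> C u \<longleftrightarrow>
     C * (\<Sum>n=1..N. real (n + 1) powr (\<alpha> - p) * cmod (u n) powr p)
     \<le> (\<Sum>n=1..N. real n powr \<alpha> * cmod (u n - u (n - 1)) powr p)"
proof -
  \<comment> \<open>The gradient at \<open>n\<close> involves \<open>u (n - 1)\<close>, so vanishing
    from \<open>N\<close> on kills both summands for \<open>n > N\<close>, while the gradient term
    at \<open>N\<close> itself may survive.\<close>
  have "infsum f {1..} = sum f {1..N}" if "\<And>n. n > N \<Longrightarrow> f n = 0" for f :: "nat \<Rightarrow> real"
  proof -
    have "infsum f {1..} = infsum f {1..N}"
      using that by (intro infsum_cong_neutral) auto
    then show ?thesis by simp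
  qed
  then show ?thesis
    using u0 by (auto simp: hardy_inequality_def discrete_gradient_def)
qed

text \<open>Eventually d(n) > c/(2n), so bounded partial sums would make a tail of the harmonic
  series summable.\<close>

lemma not_bounded_sum_asymp_harmonic:
  fixes d :: "nat \<Rightarrow> real"
  assumes c: "c > 0" and lim: "(\<lambda>n. real n * d n) \<longlonglongrightarrow> c"
    and bd: "\<And>N. N \<ge> 1 \<Longrightarrow> (\<Sum>n=1..N. d n) \<le> B"
  shows False
proof -
  have "eventually (\<lambda>n. real n * d n > c / 2) sequentially"
    using lim c by (intro order_tendstoD(1)[OF lim]) auto
  then obtain M where M: "\<And>n. n \<ge> M \<Longrightarrow> real n * d n > c / 2"
    by (auto simp: eventually_sequentially)
  define M' where "M' = Suc M"
  \<comment> \<open>The initial block, whose sign is unknown, is moved into the bound.\<close>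
  define K where "K = B - (\<Sum>n=1..M'. d n)"
  have "summable (\<lambda>n. inverse (real (n + Suc M')))"
  proof (rule bounded_imp_summable)
    fix k
    have "(\<Sum>n\<le>k. c / 2 * inverse (real (n + Suc M'))) \<le> (\<Sum>n\<le>k. d (n + Suc M'))"
    proof (rule sum_mono)
      fix n
      have "c / 2 < real (n + Suc M') * d (n + Suc M')" by (rule M) (simp add: M'_def)
      then show "c / 2 * inverse (real (n + Suc M')) \<le> d (n + Suc M')"
        by (simp add: divide_simps mult_ac del: of_nat_add of_nat_Suc)
    qed
    also have "\<dots> = (\<Sum>n=Suc M'..k + Suc M'. d n)"
      using sum.shift_bounds_cl_nat_ivl[of d 0 "Suc M'" k] by (simp add: atMost_atLeast0)
    also have "\<dots> = (\<Sum>n=1..k + Suc M'. d n) - (\<Sum>n=1..M'. d n)"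
      using sum.ub_add_nat[of 1 M' d "k + 1"] by (simp add: M'_def add_ac)
    also have "\<dots> \<le> K"
      using bd[of "k + Suc M'"] by (simp add: K_def)
    finally have "c / 2 * (\<Sum>n\<le>k. inverse (real (n + Suc M'))) \<le> K"
      by (simp only: sum_distrib_left)
    then show "(\<Sum>n\<le>k. inverse (real (n + Suc M'))) \<le> 2 * K / c"
      using c by (simp add: field_simps)
  qed auto
  then have "summable (\<lambda>n. inverse (of_nat n :: real))"
    by (subst (asm) summable_iff_shift)
  then show False
    using not_summable_harmonic[where 'a = real] by simp
qed

text \<open>For n > 0 the two sequences equal (n (1 - (1 - 1/n)^s))^p and (n/(n+1))^(1+sp), whose
  limits are elementary.\<close>

lemma hardy_terms_asymptotics:
  fixes p \<alpha> s :: real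
  assumes p: "p > 1" and s: "s > 0" and \<alpha>: "\<alpha> = p - 1 - s * p"
  shows "(\<lambda>n. real n * (real n powr \<alpha> * (real n powr s - real (n - 1) powr s) powr p)) \<longlonglongrightarrow> s powr p"
    and "(\<lambda>n. real n * (real (n + 1) powr (\<alpha> - p) * (real n powr s) powr p)) \<longlonglongrightarrow> 1"
proof -
  have "(\<lambda>n. (real n * (1 - (1 - 1 / real n) powr s)) powr p) \<longlonglongrightarrow> s powr p"
    using s by (intro tendsto_powr) (real_asymp | simp)+
  moreover have "eventually (\<lambda>n. (real n * (1 - (1 - 1 / real n) powr s)) powr p
      = real n * (real n powr \<alpha> * (real n powr s - real (n - 1) powr s) powr p)) sequentially"
    using eventually_gt_at_top[of 0]
  proof eventually_elim
    case (elim n)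
    have "(1 - 1 / real n) powr s = (real (n - 1) / real n) powr s"
      using elim by (simp add: field_simps)
    also have "\<dots> = real (n - 1) powr s / real n powr s"
      by (simp add: powr_divide)
    finally have "real n * (1 - (1 - 1 / real n) powr s)
        = real n powr (1 - s) * (real n powr s - real (n - 1) powr s)"
      using elim by (simp add: powr_diff field_simps)
    moreover have "real (n - 1) powr s \<le> real n powr s"
      using s by (intro powr_mono2) auto
    ultimately have "(real n * (1 - (1 - 1 / real n) powr s)) powr p
        = real n powr ((1 - s) * p) * (real n powr s - real (n - 1) powr s) powr p"
      by (simp add: powr_mult powr_powr)
    also have "(1 - s) * p = 1 + \<alpha>" by (simp add: \<alpha> algebra_simps)
    also have "real n powr (1 + \<alpha>) = real n * real n powr \<alpha>"
      using elim by (simp add: powr_add)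
    finally show ?case by simp
  qed
  ultimately show "(\<lambda>n. real n * (real n powr \<alpha> * (real n powr s - real (n - 1) powr s) powr p))
      \<longlonglongrightarrow> s powr p"
    by (rule Lim_transform_eventually)
next
  have "(\<lambda>n. (real n / real (n + 1)) powr (1 + s * p)) \<longlonglongrightarrow> 1 powr (1 + s * p)"
    by (intro tendsto_powr) (real_asymp | simp)+
  moreover have "eventually (\<lambda>n. (real n / real (n + 1)) powr (1 + s * p)
      = real n * (real (n + 1) powr (\<alpha> - p) * (real n powr s) powr p)) sequentially"
    using eventually_gt_at_top[of 0]
  proof eventually_elim
    case (elim n)
    have "\<alpha> - p = - (1 + s * p)" by (simp add: \<alpha>)
    then show ?case
      using elim by (simp only: powr_minus powr_divide powr_powr) (simp add: powr_add divide_inverse)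
  qed
  ultimately show "(\<lambda>n. real n * (real (n + 1) powr (\<alpha> - p) * (real n powr s) powr p)) \<longlonglongrightarrow> 1"
    by (simp add: Lim_transform_eventually)
qed

lemma hardy_const_optimal:
  fixes p \<alpha> C :: real
  assumes p: "p > 1" and \<alpha>0: "\<alpha> < 0"
    and H: "\<And>u. admissible u \<Longrightarrow> hardy_inequality p \<alpha> C u"
  shows "C \<le> hardy_const p \<alpha>"
proof (rule ccontr)
  assume C: "\<not> ?thesis"
  define s where "s = (p - \<alpha> - 1) / p"
  have s: "s > 0" using p \<alpha>0 by (simp add: s_def)
  have \<alpha>: "\<alpha> = p - 1 - s * p" using p by (simp add: s_def)
  have C: "C > s powr p" using C by (simp add: hardy_const_def s_def)
  \<comment> \<open>Positivity of \<open>C\<close> later allows the terms beyond \<open>N\<close> to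
    be discarded from the sum that \<open>C\<close> multiplies.\<close>
  then have C0: "C > 0" using powr_ge_zero[of s p] by linarith
  define a where "a n = real n powr \<alpha> * (real n powr s - real (n - 1) powr s) powr p" for n
  define b where "b n = real (n + 1) powr (\<alpha> - p) * (real n powr s) powr p" for n
  have bd: "(\<Sum>n=1..N. C * b n - a n) \<le> 1" if N: "N \<ge> 1" for N
  proof -
    \<comment> \<open>The slope N^(s-1) makes both branches equal N^s at \<open>n = N\<close>.
      Truncated subtraction gives 0 from \<open>2 * N\<close> on, and \<open>0 powr s = 0\<close>
      gives \<open>u 0 = 0\<close>.\<close>
    define u :: "nat \<Rightarrow> complex" where
      "u n = of_real (if n \<le> N then real n powr s else real N powr (s - 1) * real (2 * N - n))" for n
    have u: "u n = of_real (real n powr s)" if "n \<le> N" for n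
      using that by (simp add: u_def)
    have u_zero: "u n = 0" if "n \<ge> 2 * N" for n
      using that N by (auto simp: u_def)
    have "{n. u n \<noteq> 0} \<subseteq> {..<2 * N}"
      using u_zero by (auto simp: not_le[symmetric])
    then have "admissible u"
      using u[of 0] by (auto simp: admissible_def intro: finite_subset)
    then have "C * (\<Sum>n=1..2*N. real (n + 1) powr (\<alpha> - p) * cmod (u n) powr p)
        \<le> (\<Sum>n=1..2*N. real n powr \<alpha> * cmod (u n - u (n - 1)) powr p)"
      using H hardy_inequality_iff_sum u_zero by blast
    moreover have "(\<Sum>n=1..N. b n) \<le> (\<Sum>n=1..2*N. real (n + 1) powr (\<alpha> - p) * cmod (u n) powr p)"
    proof -
      have "(\<Sum>n=1..N. b n) = (\<Sum>n=1..N. real (n + 1) powr (\<alpha> - p) * cmod (u n) powr p)"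
        by (intro sum.cong) (auto simp: b_def u)
      also have "\<dots> \<le> (\<Sum>n=1..2*N. real (n + 1) powr (\<alpha> - p) * cmod (u n) powr p)"
        by (intro sum_mono2) auto
      finally show ?thesis .
    qed
    moreover have "(\<Sum>n=1..2*N. real n powr \<alpha> * cmod (u n - u (n - 1)) powr p) \<le> (\<Sum>n=1..N. a n) + 1"
    proof -
      have "(\<Sum>n=1..N. real n powr \<alpha> * cmod (u n - u (n - 1)) powr p) = (\<Sum>n=1..N. a n)"
      proof (intro sum.cong)
        fix n assume n: "n \<in> {1..N}"
        have "real (n - 1) powr s \<le> real n powr s"
          using s by (intro powr_mono2) auto
        moreover have "u n - u (n - 1) = of_real (real n powr s - real (n - 1) powr s)"
          using n u[of n] u[of "n - 1"] by auto
        ultimately have "cmod (u n - u (n - 1)) = real n powr s - real (n - 1) powr s"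
          by (simp only: norm_of_real abs_of_nonneg diff_ge_0_iff_ge)
        then show "real n powr \<alpha> * cmod (u n - u (n - 1)) powr p = a n"
          by (simp add: a_def)
      qed auto
      moreover have "(\<Sum>n=N+1..N+N. real n powr \<alpha> * cmod (u n - u (n - 1)) powr p) \<le> 1"
      proof -
        have "real n powr \<alpha> * cmod (u n - u (n - 1)) powr p \<le> 1 / real N" if n: "n \<in> {N+1..N+N}" for n
        proof -
          \<comment> \<open>Includes \<open>k = N\<close>, so that the first decay step, from
            \<open>N\<close> to \<open>N + 1\<close>, follows the same formula.\<close>
          have lin: "u k = of_real (real N powr (s - 1) * (2 * real N - real k))"
            if "N \<le> k" "k \<le> 2 * N" for k
          proof (cases "k = N")
            case True
            then show ?thesis using N by (simp add: u powr_diff)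
          next
            case False
            then show ?thesis using that by (simp add: u_def of_nat_diff)
          qed
          have "u n = of_real (real N powr (s - 1) * (2 * real N - real n))"
            using n by (intro lin) auto
          moreover have "u (n - 1) = of_real (real N powr (s - 1) * (2 * real N - real n + 1))"
            using n lin[of "n - 1"] by (auto simp: of_nat_diff algebra_simps)
          ultimately have "u n - u (n - 1) = of_real (- (real N powr (s - 1)))"
            by (simp only: flip: of_real_diff) (simp add: algebra_simps)
          then have "cmod (u n - u (n - 1)) = real N powr (s - 1)"
            by (simp only: norm_of_real) simp
          then have "real n powr \<alpha> * cmod (u n - u (n - 1)) powr p
              = real n powr \<alpha> * real N powr ((s - 1) * p)"
            by (simp add: powr_powr)
          \<comment> \<open>Here alpha < 0 enters. Since alpha + (s-1)p = -1, each of the N decay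
            terms costs at most 1/N, hence 1 in total.\<close>
          also have "\<dots> \<le> real N powr \<alpha> * real N powr ((s - 1) * p)"
            using n N \<alpha>0 by (intro mult_right_mono powr_mono2') auto
          also have "\<dots> = real N powr (- 1)"
            by (simp add: \<alpha> algebra_simps flip: powr_add)
          also have "\<dots> = 1 / real N"
            using N by (simp add: powr_minus_divide)
          finally show ?thesis .
        qed
        then show ?thesis
          using N sum_bounded_above[of "{N+1..N+N}" _ "1 / real N"] by fastforce
      qed
      ultimately show ?thesis
        using sum.ub_add_nat[of 1 N "\<lambda>n. real n powr \<alpha> * cmod (u n - u (n - 1)) powr p" N]
        by (simp add: mult_2)
    qed
    ultimately have "C * (\<Sum>n=1..N. b n) \<le> (\<Sum>n=1..N. a n) + 1"
      using C0 by (smt (verit) mult_left_mono)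
    then show ?thesis
      by (simp add: sum_subtractf sum_distrib_left)
  qed
  have lim: "(\<lambda>n. real n * (C * b n - a n)) \<longlonglongrightarrow> C - s powr p"
  proof -
    have "(\<lambda>n. C * (real n * b n) - real n * a n) \<longlonglongrightarrow> C * 1 - s powr p"
      unfolding a_def b_def by (intro tendsto_intros hardy_terms_asymptotics p s \<alpha>)
    then show ?thesis by (simp add: algebra_simps)
  qed
  show False
    by (rule not_bounded_sum_asymp_harmonic[OF _ lim bd]) (use C in auto)
qed

theorem theorem3:
  fixes p \<alpha> :: real
  assumes "p > 1" and "\<alpha> < 0"
  shows "(\<forall>u. admissible u \<longrightarrow> hardy_inequality p \<alpha> (hardy_const p \<alpha>) u) \<and>
         (\<forall>C::real. (\<forall>u. admissible u \<longrightarrow> hardy_inequality p \<alpha> C u) \<longrightarrow> C \<le> hardy_const p \<alpha>)"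
proof (intro conjI allI impI)
  fix u :: "nat \<Rightarrow> complex"
  assume u: "admissible u"
  then obtain N where N: "\<And>n. n \<ge> N \<Longrightarrow> u n = 0"
    unfolding admissible_def
    by (metis (mono_tags, lifting) finite_nat_set_iff_bounded mem_Collect_eq not_less)
  show "hardy_inequality p \<alpha> (hardy_const p \<alpha>) u"
    using hardy_inequality_iff_sum[OF N] weighted_discrete_Hardy[of p \<alpha> u N] assms u
    by (simp add: hardy_const_def admissible_def)
next
  fix C assume "\<forall>u. admissible u \<longrightarrow> hardy_inequality p \<alpha> C u"
  then show "C \<le> hardy_const p \<alpha>"
    using hardy_const_optimal assms by blast
qed

end
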